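(* Let $\Phi=(D,\varphi)$ be a $\mathbb{T}$-gain digraph. Then every eigenvalue of $L(\Phi)$ and every eigenvalue of $Q(\Phi)$ has nonnegative real part.
   Context: A digraph $D=(V,\mathcal{A})$ has a finite vertex set $V=\{v_1,\dots,v_n\}$ and a set $\mathcal{A}$ of ordered pairs of distinct vertices, called arcs (no loops; at most one arc from $v_i$ to $v_j$ for each ordered pair; opposite arcs may both be present). The out-degree $\deg^+(v)$ is the number of arcs leaving $v$. Let $\mathbb{T}=\{z\in\mathbb{C}:|z|=1\}$. A $\mathbb{T}$-gain digraph is a pair $\Phi=(D,\varphi)$ with $\varphi:\mathcal{A}\to\mathbb{T}$ an arbitrary function. Its gain adjacency matrix $A(\Phi)$ has entries $A(\Phi)_{ij}=\varphi(v_i,v_j)$ if $(v_i,v_j)\in\mathcal{A}$ and $0$ otherwise. With $D^+=\operatorname{diag}(\deg^+(v_1),\dots,\deg^+(v_n))$, the Laplacian and signless Laplacian are $L(\Phi)=D^+-A(\Phi)$ and $Q(\Phi)=D^++A(\Phi)$. Eigenvalues are taken over $\mathbb{C}$. *)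

theory Defs
  imports
    "Graph_Theory.Pair_Digraph"
    "Jordan_Normal_Form.Char_Poly"
begin

text \<open>
  The gain function is total on pairs, but only its values on the arcs are constrained or used.
\<close>
locale unit_gain_digraph = pair_digraph D
  for D :: "'a pair_pre_digraph" +
  fixes \<phi> :: "'a \<times> 'a \<Rightarrow> complex"
  assumes norm_gain: "e \<in> parcs D \<Longrightarrow> cmod (\<phi> e) = 1"

definition is_enumeration :: "'a list \<Rightarrow> 'a set \<Rightarrow> bool" where
  "is_enumeration vs V \<longleftrightarrow> distinct vs \<and> set vs = V"

text \<open>
  The matrices are taken with respect to an enumeration \<open>vs\<close> of the vertices, which is indexed
  from 0.
\<close>
definition gain_adj_mat :: "'a pair_pre_digraph \<Rightarrow> ('a \<times> 'a \<Rightarrow> complex) \<Rightarrow> 'a list \<Rightarrow> complex mat" where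
  "gain_adj_mat D \<phi> vs = mat (length vs) (length vs)
     (\<lambda>(i, j). if (vs ! i, vs ! j) \<in> parcs D then \<phi> (vs ! i, vs ! j) else 0)"

definition out_degree_mat :: "'a pair_pre_digraph \<Rightarrow> 'a list \<Rightarrow> complex mat" where
  "out_degree_mat D vs = mat_diag (length vs) (\<lambda>i. of_nat (out_degree (with_proj D) (vs ! i)))"

definition gain_laplacian :: "'a pair_pre_digraph \<Rightarrow> ('a \<times> 'a \<Rightarrow> complex) \<Rightarrow> 'a list \<Rightarrow> complex mat" where
  "gain_laplacian D \<phi> vs = out_degree_mat D vs - gain_adj_mat D \<phi> vs"

definition gain_signless_laplacian :: "'a pair_pre_digraph \<Rightarrow> ('a \<times> 'a \<Rightarrow> complex) \<Rightarrow> 'a list \<Rightarrow> complex mat" where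
  "gain_signless_laplacian D \<phi> vs = out_degree_mat D vs + gain_adj_mat D \<phi> vs"

end

(* Every eigenvalue lies in one of the Gershgorin discs. For both Laplacians the disc of the
   vertex v has centre deg+(v), as there are no loops, and radius deg+(v), as every gain has
   modulus 1. Such a disc is contained in the closed right half-plane. *)
theory Submission
  imports Defs
begin

text \<open>Row \<open>i\<close> is chosen where an eigenvector \<open>x\<close> has an entry of
  largest modulus. Its eigenvalue equation isolates \<open>(z - A $$ (i, i)) * x $ i\<close>, and
  every other entry of \<open>x\<close> is bounded by \<open>cmod (x $ i)\<close>, which then
  cancels.\<close>

lemma gershgorin:
  fixes A :: "complex mat"
  assumes A: "A \<in> carrier_mat n n" and ev: "eigenvalue A z"
  shows "\<exists>i<n. cmod (z - A $$ (i, i)) \<le> (\<Sum>j\<in>{..<n} - {i}. cmod (A $$ (i, j)))"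
proof -
  obtain x where x: "x \<in> carrier_vec n" "x \<noteq> 0\<^sub>v n" "A *\<^sub>v x = z \<cdot>\<^sub>v x"
    using ev A unfolding eigenvalue_def eigenvector_def by auto
  obtain k where k: "k < n" "x $ k \<noteq> 0"
    using x(1,2) by (metis carrier_vecD eq_vecI index_zero_vec(1) index_zero_vec(2))
  \<comment> \<open>The index \<open>k\<close> makes the set nonempty, so that the maximum
    exists.\<close>
  have "\<exists>i\<in>{..<n}. \<forall>j\<in>{..<n}. cmod (x $ j) \<le> cmod (x $ i)"
    using Max_in[of "(\<lambda>j. cmod (x $ j)) ` {..<n}"] Max_ge[of "(\<lambda>j. cmod (x $ j)) ` {..<n}"] k(1)
    by (fastforce simp: image_iff)
  then obtain i where i: "i < n" and max: "\<And>j. j < n \<Longrightarrow> cmod (x $ j) \<le> cmod (x $ i)"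
    by auto
  have pos: "cmod (x $ i) > 0"
    using max[OF k(1)] k(2) by (metis less_le_trans zero_less_norm_iff)
  have "z * x $ i = (A *\<^sub>v x) $ i"
    using x i by simp
  also have "\<dots> = (\<Sum>j\<in>{..<n}. A $$ (i, j) * x $ j)"
    using A x(1) i by (simp add: scalar_prod_def atLeast0LessThan)
  also have "\<dots> = A $$ (i, i) * x $ i + (\<Sum>j\<in>{..<n} - {i}. A $$ (i, j) * x $ j)"
    using i by (simp add: sum.remove)
  finally have "(z - A $$ (i, i)) * x $ i = (\<Sum>j\<in>{..<n} - {i}. A $$ (i, j) * x $ j)"
    by (simp add: algebra_simps)
  then have "cmod (z - A $$ (i, i)) * cmod (x $ i) = cmod (\<Sum>j\<in>{..<n} - {i}. A $$ (i, j) * x $ j)"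
    by (metis norm_mult)
  also have "\<dots> \<le> (\<Sum>j\<in>{..<n} - {i}. cmod (A $$ (i, j)) * cmod (x $ i))"
    by (rule sum_norm_le) (auto simp: norm_mult intro!: mult_left_mono max)
  also have "\<dots> = (\<Sum>j\<in>{..<n} - {i}. cmod (A $$ (i, j))) * cmod (x $ i)"
    by (simp add: sum_distrib_right)
  finally show ?thesis
    using pos i by (metis mult_le_cancel_right_pos)
qed

text \<open>Each arc leaving \<open>vs ! i\<close> contributes exactly 1 to its row. The set
  \<open>S\<close> will be the row without its diagonal position.\<close>

lemma (in unit_gain_digraph) gain_row_sum_le:
  assumes "distinct vs" "i < length vs" "S \<subseteq> {..<length vs}"
  shows "(\<Sum>j\<in>S. cmod (gain_adj_mat D \<phi> vs $$ (i, j)))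
           \<le> real (out_degree (with_proj D) (vs ! i))"
proof -
  let ?N = "{j. j < length vs \<and> (vs ! i, vs ! j) \<in> parcs D}"
  have "(\<Sum>j\<in>S. cmod (gain_adj_mat D \<phi> vs $$ (i, j)))
      \<le> (\<Sum>j<length vs. cmod (gain_adj_mat D \<phi> vs $$ (i, j)))"
    using assms(3) by (intro sum_mono2) auto
  also have "\<dots> = (\<Sum>j<length vs. if (vs ! i, vs ! j) \<in> parcs D then 1 else 0)"
    using assms(2) by (intro sum.cong) (auto simp: gain_adj_mat_def norm_gain)
  also have "\<dots> = real (card ?N)"
    by (simp add: sum.If_cases Int_def)
  also have "card ?N \<le> out_degree (with_proj D) (vs ! i)"
    unfolding out_degree_def
  \<comment> \<open>Since \<open>vs\<close> is distinct, different columns give different arcs out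
    of \<open>vs ! i\<close>.\<close>
  proof (rule card_inj_on_le)
    show "inj_on (\<lambda>j. (vs ! i, vs ! j)) ?N"
      using assms(1) by (auto simp: inj_on_def nth_eq_iff_index_eq)
  qed (auto simp: out_arcs_def)
  finally show ?thesis by simp
qed

text \<open>A general \<open>M\<close> serves both Laplacians at once: they differ only in the sign
  of the off-diagonal entries, and the disc radii depend only on moduli.\<close>

lemma (in unit_gain_digraph) Re_eigenvalue_nonneg:
  assumes "distinct vs" and M: "M \<in> carrier_mat (length vs) (length vs)"
    and diag: "\<And>i. i < length vs \<Longrightarrow>
      M $$ (i, i) = of_nat (out_degree (with_proj D) (vs ! i))"
    and off_diag: "\<And>i j. i < length vs \<Longrightarrow> j < length vs \<Longrightarrow> i \<noteq> j \<Longrightarrow>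
      cmod (M $$ (i, j)) = cmod (gain_adj_mat D \<phi> vs $$ (i, j))"
    and "eigenvalue M z"
  shows "Re z \<ge> 0"
proof -
  obtain i where i: "i < length vs" and
    disc: "cmod (z - M $$ (i, i)) \<le> (\<Sum>j\<in>{..<length vs} - {i}. cmod (M $$ (i, j)))"
    using gershgorin[OF M assms(5)] by auto
  note disc
  also have "\<dots> = (\<Sum>j\<in>{..<length vs} - {i}. cmod (gain_adj_mat D \<phi> vs $$ (i, j)))"
    using i by (intro sum.cong) (auto simp: off_diag)
  also have "\<dots> \<le> real (out_degree (with_proj D) (vs ! i))"
    using assms(1) i by (rule gain_row_sum_le) auto
  \<comment> \<open>With \<open>d\<close> the out-degree, \<open>Re z - d\<close> has absolute value
    at most \<open>d\<close>, hence \<open>Re z\<close> is at least 0.\<close>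
  finally show ?thesis
    using abs_Re_le_cmod[of "z - M $$ (i, i)"] diag[OF i] by simp
qed

theorem theorem5p7:
  fixes D :: "'a pair_pre_digraph" and \<phi> :: "'a \<times> 'a \<Rightarrow> complex" and vs :: "'a list"
  assumes "unit_gain_digraph D \<phi>"
    and "is_enumeration vs (pverts D)"
  shows "(\<forall>z. eigenvalue (gain_laplacian D \<phi> vs) z \<longrightarrow> Re z \<ge> 0) \<and>
         (\<forall>z. eigenvalue (gain_signless_laplacian D \<phi> vs) z \<longrightarrow> Re z \<ge> 0)"
proof -
  interpret unit_gain_digraph D \<phi> by fact
  have vs: "distinct vs"
    using assms(2) by (simp add: is_enumeration_def)
  \<comment> \<open>This makes the diagonal of the adjacency matrix vanish, so the disc centres are
    exactly the out-degrees.\<close>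
  have no_loop: "(v, v) \<notin> parcs D" for v
    using no_loops[of "(v, v)"] by auto
  note defs = gain_laplacian_def gain_signless_laplacian_def out_degree_mat_def gain_adj_mat_def
    mat_diag_def
  show ?thesis
    \<comment> \<open>The goal \<open>Re z \<ge> 0\<close> does not determine \<open>M\<close>; with
      the eigenvalue premise rotated to the front, \<open>assumption\<close> fixes it.\<close>
    by (intro conjI allI impI; rule Re_eigenvalue_nonneg[OF vs, rotated 3], assumption)
      (auto simp: defs no_loop)
qed

end
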